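(* Let $\mathcal H,\mathcal G$ be Hilbert spaces, let $\mathcal D\subset\mathcal G$ be nonempty, let $I_1=\{1,\dots,m\}$, $I_2=\{m+1,\dots,n\}$, and let $f_i:\mathcal D\to\mathbb R$, $g_i:\mathcal D\to\mathcal H$, $i\in I_1\cup I_2$, be Lipschitz on $\mathcal D$. Let $\mathbb C:\mathcal D\rightrightarrows\mathcal H$ be the multifunction $\mathbb C(p)=C(p)$, where $$C(p)=\{x\in\mathcal H \mid \langle x\mid g_i(p)\rangle=f_i(p),\ i\in I_1,\ \ \langle x\mid g_i(p)\rangle\le f_i(p),\ i\in I_2\}.$$ Let $\bar p\in\mathcal D$ and $\bar x\in C(\bar p)$, and suppose that $\mathbb C$ satisfies RCRCQ at $(\bar p,\bar x)$ and that $\bar x\in\liminf_{p\to\bar p}\mathbb C(p)$. Then $\mathbb C$ is Lipschitz-like at $(\bar p,\bar x)$.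
   Context: Hilbert spaces are real, with inner product $\langle\cdot\mid\cdot\rangle$. Neighbourhoods of $\bar p$ are understood relative to $\mathcal D$. Active index set: for $p\in\mathcal D$, $x\in\mathcal H$, $I_p(x)=\{i\in I_1\cup I_2\mid \langle x\mid g_i(p)\rangle-f_i(p)=0\}$. RCRCQ (relaxed constant rank constraint qualification) holds for $\mathbb C$ at $(\bar p,\bar x)$, $\bar x\in C(\bar p)$, if there exists a neighbourhood $U(\bar p)$ of $\bar p$ such that for every index set $J$ with $I_1\subset J\subset I_{\bar p}(\bar x)$ one has $\operatorname{rank}(g_i(p),i\in J)=\operatorname{rank}(g_i(\bar p),i\in J)$ for all $p\in U(\bar p)$, where the rank of a finite family of vectors is the dimension of its linear span. Lower limit: $\liminf_{p\to\bar p}\mathbb C(p)=\{y\in\mathcal H\mid \forall\,p_k\to\bar p\ (p_k\in\mathcal D)\ \exists\,y_k\in\mathbb C(p_k),\ y_k\to y\}$; equivalently, $\bar x$ belongs to it iff for every neighbourhood $V(\bar x)$ of $\bar x$ there is a neighbourhood $U(\bar p)$ of $\bar p$ such that $\mathbb C(p)\cap V(\bar x)\neq\emptyset$ for all $p\in U(\bar p)$. Lipschitz-like: $\mathbb C$ is Lipschitz-like at $(\bar p,\bar x)$ if there exist a constant $\ell>0$, a neighbourhood $U(\bar p)$ of $\bar p$ and a neighbourhood $V(\bar x)$ of $\bar x$ such that for all $p_1,p_2\in U(\bar p)$, $\mathbb C(p_1)\cap V(\bar x)\subset\mathbb C(p_2)+\ell\|p_1-p_2\|B$, where $B$ is the open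 unit ball of $\mathcal H$. *)

theory Defs
  imports "HOL-Analysis.Analysis"
begin

text \<open>
  Index sets are \<open>I\<^sub>1 = {1..m}\<close> and \<open>I\<^sub>2 = {m+1..n}\<close>. The data \<open>f i\<close>, \<open>g i\<close> are total functions,
  but only their values on the parameter set \<open>D\<close> are ever used. A neighbourhood of a parameter
  is a relatively open subset of \<open>D\<close> containing it.
\<close>

definition feasible_set ::
  "nat \<Rightarrow> nat \<Rightarrow> (nat \<Rightarrow> 'g \<Rightarrow> real) \<Rightarrow> (nat \<Rightarrow> 'g \<Rightarrow> 'h::real_inner) \<Rightarrow> 'g \<Rightarrow> 'h set"
  where "feasible_set m n f g p =
    {x. (\<forall>i\<in>{1..m}. x \<bullet> g i p = f i p) \<and> (\<forall>i\<in>{m+1..n}. x \<bullet> g i p \<le> f i p)}"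

definition active_indices ::
  "nat \<Rightarrow> nat \<Rightarrow> (nat \<Rightarrow> 'g \<Rightarrow> real) \<Rightarrow> (nat \<Rightarrow> 'g \<Rightarrow> 'h::real_inner) \<Rightarrow> 'g \<Rightarrow> 'h \<Rightarrow> nat set"
  where "active_indices m n f g p x = {i \<in> {1..m} \<union> {m+1..n}. x \<bullet> g i p - f i p = 0}"

definition family_rank :: "('i \<Rightarrow> 'h::real_vector) \<Rightarrow> 'i set \<Rightarrow> nat"
  where "family_rank v J = dim (span (v ` J))"

definition RCRCQ ::
  "nat \<Rightarrow> nat \<Rightarrow> 'g::topological_space set \<Rightarrow> (nat \<Rightarrow> 'g \<Rightarrow> real) \<Rightarrow>
    (nat \<Rightarrow> 'g \<Rightarrow> 'h::real_inner) \<Rightarrow> 'g \<Rightarrow> 'h \<Rightarrow> bool"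
  where "RCRCQ m n D f g pbar xbar \<longleftrightarrow>
    (\<exists>U. openin (top_of_set D) U \<and> pbar \<in> U \<and>
      (\<forall>J. {1..m} \<subseteq> J \<and> J \<subseteq> active_indices m n f g pbar xbar \<longrightarrow>
        (\<forall>p\<in>U. family_rank (\<lambda>i. g i p) J = family_rank (\<lambda>i. g i pbar) J)))"

text \<open>
  The selection \<open>y\<close> is only required to lie in \<open>F (p k)\<close> for all large \<open>k\<close>: values of \<open>F\<close> far
  from \<open>pbar\<close> may be empty. With this reading the sequential definition agrees with the
  neighbourhood characterization, see \<open>mem_lower_limit_iff\<close>.
\<close>

definition lower_limit ::
  "'g::topological_space set \<Rightarrow> ('g \<Rightarrow> 'h::topological_space set) \<Rightarrow> 'g \<Rightarrow> 'h set"
  where "lower_limit D F pbar =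
    {x. \<forall>p. (\<forall>k. p k \<in> D) \<and> p \<longlonglongrightarrow> pbar \<longrightarrow>
      (\<exists>y. (\<forall>\<^sub>F k in sequentially. y k \<in> F (p k)) \<and> y \<longlonglongrightarrow> x)}"

text \<open>
  The summand is the scaled open unit ball, which is \<open>{0}\<close> for \<open>p\<^sub>1 = p\<^sub>2\<close>; it must not be replaced
  by the open ball of radius \<open>l * norm (p\<^sub>1 - p\<^sub>2)\<close>, which is then empty.
\<close>

definition lipschitz_like ::
  "'g::real_normed_vector set \<Rightarrow> ('g \<Rightarrow> 'h::real_normed_vector set) \<Rightarrow> 'g \<Rightarrow> 'h \<Rightarrow> bool"
  where "lipschitz_like D F pbar xbar \<longleftrightarrow>
    (\<exists>l>0. \<exists>U V. openin (top_of_set D) U \<and> pbar \<in> U \<and> open V \<and> xbar \<in> V \<and>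
      (\<forall>p\<^sub>1\<in>U. \<forall>p\<^sub>2\<in>U.
        F p\<^sub>1 \<inter> V \<subseteq> {y + (l * norm (p\<^sub>1 - p\<^sub>2)) *\<^sub>R b | y b. y \<in> F p\<^sub>2 \<and> b \<in> ball 0 1}))"

lemma mem_lower_limit_iff:
  fixes F :: "'g::metric_space \<Rightarrow> 'h::metric_space set"
  assumes "pbar \<in> D"
  shows "x \<in> lower_limit D F pbar \<longleftrightarrow>
    (\<forall>V. open V \<and> x \<in> V \<longrightarrow>
      (\<exists>U. openin (top_of_set D) U \<and> pbar \<in> U \<and> (\<forall>p\<in>U. F p \<inter> V \<noteq> {})))"
    (is "?L \<longleftrightarrow> ?R")
proof
  assume L: ?L
  show ?R
  proof (rule ccontr)
    assume "\<not> ?R"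
    then obtain V where V: "open V" "x \<in> V"
      and "\<nexists>U. openin (top_of_set D) U \<and> pbar \<in> U \<and> (\<forall>p\<in>U. F p \<inter> V \<noteq> {})"
      by (simp only: not_all not_imp) (elim exE conjE, rule that)
    hence no: "\<exists>p\<in>U. F p \<inter> V = {}" if "openin (top_of_set D) U" "pbar \<in> U" for U
      using that by metis
    have "\<exists>p. p \<in> D \<and> dist pbar p < inverse (real (Suc k)) \<and> F p \<inter> V = {}" for k
    proof -
      have "pbar \<in> D \<inter> ball pbar (inverse (real (Suc k)))" using assms by simp
      from no[OF openin_open_Int[OF open_ball] this]
      obtain q where "q \<in> D \<inter> ball pbar (inverse (real (Suc k)))" "F q \<inter> V = {}"
        by (elim bexE) (rule that)
      thus ?thesis by (intro exI[of _ q]) simp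
    qed
    then obtain p where p: "\<And>k. p k \<in> D" "\<And>k. dist pbar (p k) < inverse (real (Suc k))"
      "\<And>k. F (p k) \<inter> V = {}" by metis
    have "p \<longlonglongrightarrow> pbar"
    proof (rule tendstoI)
      fix e :: real assume "e > 0"
      have "\<forall>\<^sub>F k in sequentially. inverse (real (Suc k)) < e"
        using order_tendstoD(2)[OF LIMSEQ_inverse_real_of_nat \<open>e > 0\<close>] .
      thus "\<forall>\<^sub>F k in sequentially. dist (p k) pbar < e"
      proof eventually_elim
        case (elim k)
        show ?case using less_trans[OF p(2)[of k] elim] by (simp only: dist_commute)
      qed
    qed
    with L p(1) obtain y where y: "\<forall>\<^sub>F k in sequentially. y k \<in> F (p k)" "y \<longlonglongrightarrow> x"
      unfolding lower_limit_def by blast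
    have "\<forall>\<^sub>F k in sequentially. y k \<in> V" using y(2) V by (rule topological_tendstoD)
    with y(1) have "\<forall>\<^sub>F k in sequentially. y k \<in> F (p k) \<inter> V" by eventually_elim auto
    thus False using p(3) by auto
  qed
next
  assume R: ?R
  have "\<exists>y. (\<forall>\<^sub>F k in sequentially. y k \<in> F (p k)) \<and> y \<longlonglongrightarrow> x"
    if p: "\<forall>k. p k \<in> D" "p \<longlonglongrightarrow> pbar" for p
  proof -
    have ev: "\<forall>\<^sub>F k in sequentially. F (p k) \<inter> ball x e \<noteq> {}" if "e > 0" for e
    proof -
      have "open (ball x e) \<and> x \<in> ball x e" using \<open>e > 0\<close> by simp
      with R obtain U where U: "openin (top_of_set D) U" "pbar \<in> U"
        "\<forall>p\<in>U. F p \<inter> ball x e \<noteq> {}" by blast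
      from U(1) obtain T where T: "open T" "U = D \<inter> T" unfolding openin_open by blast
      have "\<forall>\<^sub>F k in sequentially. p k \<in> T"
        using p(2) T U(2) by (intro topological_tendstoD) auto
      thus ?thesis by eventually_elim (use p(1) U(3) T(2) in blast)
    qed
    define near where "near k z \<longleftrightarrow> z \<in> F (p k) \<and> dist x z < infdist x (F (p k)) + inverse (real (Suc k))"
      for k z
    have ex: "\<exists>z. near k z" if "F (p k) \<noteq> {}" for k
    proof -
      have "\<exists>z\<in>F (p k). dist x z < infdist x (F (p k)) + inverse (real (Suc k))"
        using cInf_lessD[of "dist x ` F (p k)" "infdist x (F (p k)) + inverse (real (Suc k))"]
          infdist_notempty[OF that, of x] that by auto
      thus ?thesis unfolding near_def by blast
    qed
    define y where "y k = (SOME z. near k z)" for k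
    have y: "near k (y k)" if "F (p k) \<noteq> {}" for k
      unfolding y_def using ex[OF that] by (rule someI_ex)
    have "\<forall>\<^sub>F k in sequentially. y k \<in> F (p k)"
      using ev[OF zero_less_one] by eventually_elim (use y near_def in blast)
    moreover have "y \<longlonglongrightarrow> x"
    proof (rule tendstoI)
      fix e :: real assume "e > 0"
      hence "e / 2 > 0" by simp
      have "\<forall>\<^sub>F k in sequentially. inverse (real (Suc k)) < e / 2"
        using order_tendstoD(2)[OF LIMSEQ_inverse_real_of_nat \<open>e / 2 > 0\<close>] .
      with ev[OF \<open>e / 2 > 0\<close>] show "\<forall>\<^sub>F k in sequentially. dist (y k) x < e"
      proof eventually_elim
        case (elim k)
        then obtain z where z: "z \<in> F (p k)" "dist x z < e / 2" by auto
        hence "infdist x (F (p k)) < e / 2" using infdist_le[OF z(1), of x] by linarith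
        moreover have "near k (y k)" using y elim(1) by blast
        ultimately have "dist x (y k) < e" using elim(2) unfolding near_def by linarith
        thus ?case by (simp only: dist_commute)
      qed
    qed
    ultimately show ?thesis by blast
  qed
  thus ?L unfolding lower_limit_def by blast
qed

end

theory Submission
  imports Defs
begin

text \<open>
  Fix parameters \<open>p\<close>, \<open>q\<close> near \<open>pbar\<close> and a point \<open>x \<in> C(p)\<close> near \<open>xbar\<close>, and let \<open>z\<close> be the
  nearest point to \<open>x\<close> in the closed convex set \<open>C(q)\<close>. Since \<open>xbar\<close> is in the lower limit, \<open>C(q)\<close>
  has points near \<open>xbar\<close>, so \<open>z\<close> is near \<open>xbar\<close> too, and every constraint active at \<open>z\<close> is active
  at \<open>xbar\<close>. Optimality of \<open>z\<close> and Farkas' lemma give multipliers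
  \<open>x - z = (\<Sum>i\<in>S. u i *\<^sub>R g i q)\<close> with \<open>S\<close> a set of active indices and \<open>u i \<ge> 0\<close> on inequalities
  (\<open>nearest_point_multipliers\<close>). Pairing this identity with \<open>x - z\<close> gives
  \<open>norm (x - z) ^ 2 = (\<Sum>i\<in>S. u i * (x \<bullet> g i q - f i q))\<close>, and because \<open>x\<close> is feasible at \<open>p\<close>,
  the residuals that count here are \<open>O(norm (p - q))\<close> by the Lipschitz assumption. The estimate
  \<open>norm (x - z) = O(norm (p - q))\<close> follows as soon as
  \<open>(\<Sum>i\<in>S. \<bar>u i\<bar>) \<le> c * norm (x - z)\<close> with \<open>c\<close> independent of \<open>p\<close>, \<open>q\<close> and \<open>x\<close>
  (\<open>distance_le_residual\<close>).

  This last bound is where constancy of rank enters. A fixed linearly independent family has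
  uniformly bounded coefficients, and this persists under small perturbations of its members
  (\<open>uniform_coefficient_bound\<close>); there are only finitely many index sets \<open>S\<close>. So it suffices to
  arrange that the vectors \<open>g i pbar\<close>, \<open>i \<in> S\<close>, are linearly independent. Choose once and for all
  indices \<open>E\<close> of equality constraints for which the \<open>g i pbar\<close>, \<open>i \<in> E\<close>, form a basis of the span
  of all equality gradients at \<open>pbar\<close>; by constant rank they do so at nearby \<open>q\<close> as well.
  Caratheodory's reduction, never discarding an index of \<open>E\<close>, makes the family independent
  at \<open>q\<close>. Finally \<open>S\<close> and \<open>{1..m} \<union> S\<close> have the same rank at \<open>q\<close> and at \<open>pbar\<close>, and
  the rank of the latter family does not change from \<open>q\<close> to \<open>pbar\<close>: independence at \<open>q\<close> is
  pulled back to independence at \<open>pbar\<close> (\<open>independent_family_pullback\<close>).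
\<close>

section \<open>Nearest points in closed convex subsets of a Hilbert space\<close>

text \<open>
  By the parallelogram law two points of \<open>S\<close> that are both almost nearest to \<open>x\<close> are close to each
  other, because their midpoint lies in \<open>S\<close>. Hence a minimising sequence is Cauchy.
\<close>

lemma nearest_point_exists:
  fixes S :: "'h::{real_inner, complete_space} set"
  assumes "closed S" "convex S" "S \<noteq> {}"
  shows "\<exists>z\<in>S. \<forall>y\<in>S. dist x z \<le> dist x y"
proof -
  define d where "d = infdist x S"
  have d_le: "d \<le> norm (x - y)" if "y \<in> S" for y
    using infdist_le[OF that, of x] by (simp add: d_def dist_norm)
  have d0: "d \<ge> 0" by (simp add: d_def infdist_nonneg)
  have "\<exists>y\<in>S. (norm (x - y))\<^sup>2 < d\<^sup>2 + 1 / real (Suc k)" for k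
  proof -
    have "d < sqrt (d\<^sup>2 + 1 / real (Suc k))"
      by (rule real_less_rsqrt) simp
    then obtain y where "y \<in> S" "dist x y < sqrt (d\<^sup>2 + 1 / real (Suc k))"
      using cInf_lessD[of "dist x ` S"] infdist_notempty[OF assms(3), of x] assms(3)
      by (auto simp: d_def)
    moreover from this(2) have "(norm (x - y))\<^sup>2 < (sqrt (d\<^sup>2 + 1 / real (Suc k)))\<^sup>2"
      by (intro power_strict_mono) (auto simp: dist_norm)
    ultimately show ?thesis by (auto intro!: bexI[of _ y] simp del: of_nat_Suc)
  qed
  then obtain y where y: "\<And>k. y k \<in> S" "\<And>k. (norm (x - y k))\<^sup>2 < d\<^sup>2 + 1 / real (Suc k)"
    by metis
  have gap: "(norm (u - v))\<^sup>2 \<le> 2 * (norm (x - u))\<^sup>2 + 2 * (norm (x - v))\<^sup>2 - 4 * d\<^sup>2"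
    if "u \<in> S" "v \<in> S" for u v
  proof -
    define c where "c = (1/2) *\<^sub>R u + (1/2) *\<^sub>R v"
    have "c \<in> S" unfolding c_def using convexD[OF assms(2) that, of "1/2" "1/2"] by simp
    then have "d\<^sup>2 \<le> (norm (x - c))\<^sup>2" using d_le d0 by (intro power_mono) auto
    moreover have "(norm (u - v))\<^sup>2 + 4 * (norm (x - c))\<^sup>2
        = 2 * (norm (x - u))\<^sup>2 + 2 * (norm (x - v))\<^sup>2"
      unfolding c_def power2_norm_eq_inner
      by (simp add: inner_commute algebra_simps)
    ultimately show ?thesis by linarith
  qed
  have "Cauchy y"
  proof (rule metric_CauchyI)
    fix e :: real assume "e > 0"
    then have "e\<^sup>2 / 4 > 0" by simp
    then obtain N where N: "1 / real (Suc N) < e\<^sup>2 / 4" using nat_approx_posE by blast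
    have "dist (y k) (y l) < e" if "k \<ge> N" "l \<ge> N" for k l
    proof -
      have "1 / real (Suc j) \<le> 1 / real (Suc N)" if "j \<ge> N" for j
        using that by (intro divide_left_mono) auto
      from this[OF that(1)] this[OF that(2)]
      have "(norm (y k - y l))\<^sup>2 < e\<^sup>2"
        using gap[OF y(1)[of k] y(1)[of l]] y(2)[of k] y(2)[of l] N by linarith
      then show ?thesis
        using \<open>e > 0\<close> power_less_imp_less_base[of "norm (y k - y l)" 2 e] by (simp add: dist_norm)
    qed
    then show "\<exists>M. \<forall>m\<ge>M. \<forall>n\<ge>M. dist (y m) (y n) < e" by blast
  qed
  then obtain z where z: "y \<longlonglongrightarrow> z" using Cauchy_convergent convergent_def by blast
  have "z \<in> S" using closed_sequentially[OF assms(1) y(1) z] .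
  have "(\<lambda>k. (norm (x - y k))\<^sup>2) \<longlonglongrightarrow> (norm (x - z))\<^sup>2"
    by (intro tendsto_intros z)
  moreover have "(\<lambda>k. d\<^sup>2 + 1 / real (Suc k)) \<longlonglongrightarrow> d\<^sup>2"
    using tendsto_add[OF tendsto_const LIMSEQ_inverse_real_of_nat, of "d\<^sup>2"]
    by (simp add: inverse_eq_divide)
  ultimately have "(norm (x - z))\<^sup>2 \<le> d\<^sup>2"
    using y(2) by (intro LIMSEQ_le[where X = "\<lambda>k. (norm (x - y k))\<^sup>2"]) (auto intro: less_imp_le)
  then have "norm (x - z) \<le> d" using d0 power2_le_imp_le by blast
  then show ?thesis using \<open>z \<in> S\<close> d_le by (force simp: dist_norm)
qed

section \<open>Farkas' lemma\<close>

text \<open>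
  Inequalities are indexed by \<open>A - E\<close>, equations by \<open>A \<inter> E\<close>. The proof (due to Bartl) is a purely
  algebraic induction on the number of constraints. If the constraint \<open>j\<close> cannot be dropped, some \<open>w\<close> satisfies the other
  constraints and has \<open>w \<bullet> v > 0\<close>. Projecting along \<open>w\<close> onto the hyperplane orthogonal to \<open>a j\<close>
  reduces to the remaining constraints, and the sign of the multiplier of \<open>j\<close> comes from \<open>w\<close>.
\<close>

lemma mixed_Farkas:
  fixes a :: "'i \<Rightarrow> 'h::real_inner"
  assumes "finite A"
    and "\<And>x. (\<forall>i\<in>A. if i \<in> E then x \<bullet> a i = 0 else x \<bullet> a i \<le> 0) \<Longrightarrow> x \<bullet> v \<le> 0"
  shows "\<exists>u. v = (\<Sum>i\<in>A. u i *\<^sub>R a i) \<and> (\<forall>i\<in>A - E. 0 \<le> u i)"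
  using assms
proof (induction A arbitrary: a v)
  case empty
  from empty(1)[of v] have "v = 0" by (metis empty_iff inner_gt_zero_iff not_le)
  then show ?case by simp
next
  case (insert j A)
  let ?adm = "\<lambda>a x. \<forall>i\<in>A. if i \<in> E then x \<bullet> a i = 0 else x \<bullet> a i \<le> 0"
  show ?case
  proof (cases "\<forall>x. ?adm a x \<longrightarrow> x \<bullet> v \<le> 0")
    case True
    then obtain u where u: "v = (\<Sum>i\<in>A. u i *\<^sub>R a i)" "\<forall>i\<in>A - E. 0 \<le> u i"
      using insert.IH[of a v] by blast
    have "(\<Sum>i\<in>insert j A. (u(j := 0)) i *\<^sub>R a i) = (\<Sum>i\<in>A. u i *\<^sub>R a i)"
      using insert.hyps by (auto intro!: sum.cong)
    with u show ?thesis by (intro exI[of _ "u(j := 0)"]) auto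
  next
    case False
    then obtain w where w: "?adm a w" "w \<bullet> v > 0" by force
    define \<alpha> where "\<alpha> = w \<bullet> a j"
    have \<alpha>: "\<alpha> \<noteq> 0" "j \<notin> E \<Longrightarrow> \<alpha> > 0"
      using insert.prems[of w] w unfolding \<alpha>_def by force+
    define a' where "a' i = a i - ((w \<bullet> a i) / \<alpha>) *\<^sub>R a j" for i
    define v' where "v' = v - ((w \<bullet> v) / \<alpha>) *\<^sub>R a j"
    have "x \<bullet> v' \<le> 0" if x: "?adm a' x" for x
    proof -
      define x' where "x' = x - ((x \<bullet> a j) / \<alpha>) *\<^sub>R w"
      have "x' \<bullet> a i = x \<bullet> a' i" for i
        by (simp add: x'_def a'_def inner_diff_left inner_diff_right)
      moreover have "x' \<bullet> a j = 0"
        using \<alpha>(1) by (simp add: x'_def \<alpha>_def inner_diff_left)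
      ultimately have "x' \<bullet> v \<le> 0" using x insert.prems[of x'] by simp
      then show ?thesis
        by (simp add: x'_def v'_def inner_diff_left inner_diff_right mult.commute)
    qed
    then obtain u where u: "v' = (\<Sum>i\<in>A. u i *\<^sub>R a' i)" "\<forall>i\<in>A - E. 0 \<le> u i"
      using insert.IH[of a' v'] by blast
    define s where "s = (\<Sum>i\<in>A. u i * (w \<bullet> a i))"
    define t where "t = (w \<bullet> v - s) / \<alpha>"
    have "(\<Sum>i\<in>A. u i *\<^sub>R a' i) = (\<Sum>i\<in>A. u i *\<^sub>R a i) - (s / \<alpha>) *\<^sub>R a j"
      by (simp add: a'_def s_def scaleR_diff_right sum_subtractf sum_divide_distrib
          flip: scaleR_sum_left)
    with u(1) have "v = (\<Sum>i\<in>A. u i *\<^sub>R a i) + t *\<^sub>R a j"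
      by (simp add: v'_def t_def diff_divide_distrib scaleR_diff_left algebra_simps)
    moreover have "(\<Sum>i\<in>A. (u(j := t)) i *\<^sub>R a i) = (\<Sum>i\<in>A. u i *\<^sub>R a i)"
      using insert.hyps by (auto intro!: sum.cong)
    ultimately have "v = (\<Sum>i\<in>insert j A. (u(j := t)) i *\<^sub>R a i)"
      using insert.hyps by simp
    moreover have "0 \<le> t" if "j \<notin> E"
    proof -
      have "s \<le> 0" unfolding s_def
        using w(1) u(2) by (intro sum_nonpos) (force intro: mult_nonneg_nonpos split: if_splits)
      then show ?thesis using \<alpha>(2)[OF that] w(2) by (simp add: t_def)
    qed
    ultimately show ?thesis using u(2) by (intro exI[of _ "u(j := t)"]) auto
  qed
qed

section \<open>Linearly independent families and their rank\<close>

text \<open>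
  Independence is that of the family, not of its image: a repeated vector makes it dependent.
\<close>

definition independent_family :: "('i \<Rightarrow> 'h::real_vector) \<Rightarrow> 'i set \<Rightarrow> bool"
  where "independent_family a S \<longleftrightarrow>
    (\<forall>c. (\<Sum>i\<in>S. c i *\<^sub>R a i) = 0 \<longrightarrow> (\<forall>i\<in>S. c i = 0))"

lemma independent_family_iff_independent_image:
  assumes "finite S"
  shows "independent_family a S \<longleftrightarrow> inj_on a S \<and> independent (a ` S)"
proof
  assume L: "independent_family a S"
  have "inj_on a S"
  proof (rule inj_onI, rule ccontr)
    fix i j assume ij: "i \<in> S" "j \<in> S" "a i = a j" "i \<noteq> j"
    define c :: "_ \<Rightarrow> real" where "c k = (if k = i then 1 else if k = j then - 1 else 0)" for k
    have "(\<Sum>k\<in>S. c k *\<^sub>R a k) = (\<Sum>k\<in>{i, j}. c k *\<^sub>R a k)"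
      using ij assms by (intro sum.mono_neutral_right) (auto simp: c_def)
    also have "\<dots> = 0" using ij by (simp add: c_def)
    finally have "c i = 0" using L ij(1) unfolding independent_family_def by blast
    then show False by (simp add: c_def)
  qed
  moreover have "independent (a ` S)"
  proof (rule independent_if_scalars_zero)
    fix c x assume "(\<Sum>x\<in>a ` S. c x *\<^sub>R x) = 0" "x \<in> a ` S"
    then show "c x = 0"
      using L \<open>inj_on a S\<close> unfolding independent_family_def
      by (auto simp: sum.reindex dest: spec[of _ "\<lambda>i. c (a i)"])
  qed (use assms in simp)
  ultimately show "inj_on a S \<and> independent (a ` S)" ..
next
  assume R: "inj_on a S \<and> independent (a ` S)"
  show "independent_family a S"
    unfolding independent_family_def
  proof (intro allI impI ballI)
    fix c i assume c: "(\<Sum>i\<in>S. c i *\<^sub>R a i) = 0" "i \<in> S"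
    define h where "h = c \<circ> the_inv_into S a"
    have h: "h (a i) = c i" if "i \<in> S" for i
      using R that by (simp add: h_def the_inv_into_f_f)
    have "(\<Sum>x\<in>a ` S. h x *\<^sub>R x) = 0"
      using R c(1) by (simp add: sum.reindex h)
    then have "h (a i) = 0"
      using R c(2) assms independentD[of "a ` S" "a ` S" h "a i"] by auto
    then show "c i = 0" using h c(2) by simp
  qed
qed

lemma independent_family_iff_full_rank:
  assumes "finite S"
  shows "independent_family a S \<longleftrightarrow> family_rank a S = card S"
proof
  assume "independent_family a S"
  then have "inj_on a S" "independent (a ` S)"
    using independent_family_iff_independent_image[OF assms] by blast+
  then show "family_rank a S = card S"
    by (simp add: family_rank_def dim_eq_card_independent card_image)
next
  assume rank: "family_rank a S = card S"
  obtain B where B: "B \<subseteq> a ` S" "independent B" "a ` S \<subseteq> span B"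
    using maximal_independent_subset by blast
  have "card B = card S"
    using basis_card_eq_dim[OF B(1,3,2)] rank by (simp add: family_rank_def)
  moreover have "card B \<le> card (a ` S)" using B(1) assms by (intro card_mono) auto
  moreover have "card (a ` S) \<le> card S" using assms by (rule card_image_le)
  ultimately have "card (a ` S) = card S" "B = a ` S"
    using card_subset_eq[of "a ` S" B] B(1) assms by auto
  then show "independent_family a S"
    using B(2) assms eq_card_imp_inj_on
    by (auto simp: independent_family_iff_independent_image)
qed

lemma spanning_subfamily_exists:
  assumes "finite I"
  obtains E where "E \<subseteq> I" "independent_family a E" "a ` I \<subseteq> span (a ` E)"
proof -
  obtain B where B: "B \<subseteq> a ` I" "independent B" "a ` I \<subseteq> span B"
    using maximal_independent_subset by blast
  then obtain E where "E \<subseteq> I" "inj_on a E" "B = a ` E" by (auto simp: subset_image_inj)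
  moreover have "finite E" using calculation assms finite_subset by blast
  ultimately show ?thesis
    using that B independent_family_iff_independent_image by blast
qed

lemma family_rank_cong_span:
  assumes "E \<subseteq> I" "a ` I \<subseteq> span (a ` E)"
  shows "family_rank a (E \<union> K) = family_rank a (I \<union> K)"
proof -
  have "span (a ` (E \<union> K)) = span (a ` (I \<union> K))"
  proof (rule span_eq[THEN iffD2], intro conjI)
    show "a ` (E \<union> K) \<subseteq> span (a ` (I \<union> K))"
      using assms(1) by (auto intro: span_base)
    have "span (a ` E) \<subseteq> span (a ` (E \<union> K))" by (intro span_mono) auto
    then show "a ` (I \<union> K) \<subseteq> span (a ` (E \<union> K))"
      using assms(2) by (auto intro: span_base)
  qed
  then show ?thesis by (simp add: family_rank_def)
qed

text \<open>
  In infinite dimension the usual dimension comparison has to go through finite bases: the family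
  \<open>E\<close> extends to a basis of the span of \<open>I\<close>, which has no room for a further vector.
\<close>

lemma full_rank_subfamily_spans:
  assumes "finite I" "E \<subseteq> I" "independent_family a E" "family_rank a I = card E"
  shows "a ` I \<subseteq> span (a ` E)"
proof -
  have "finite E" using assms finite_subset by blast
  then have E: "inj_on a E" "independent (a ` E)"
    using assms(3) independent_family_iff_independent_image by blast+
  obtain B where B: "a ` E \<subseteq> B" "B \<subseteq> a ` I" "independent B" "a ` I \<subseteq> span B"
    using maximal_independent_subset_extend[of "a ` E" "a ` I"] E assms(2) by blast
  have "card B = card (a ` E)"
    using basis_card_eq_dim[OF B(2,4,3)] assms(4) E by (simp add: family_rank_def card_image)
  moreover have "finite B" using B(2) assms(1) finite_subset by blast
  ultimately have "a ` E = B" using B(1) by (intro card_subset_eq) auto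
  then show ?thesis using B(4) by simp
qed

text \<open>
  Constancy of the rank is only known for index sets that contain all of \<open>I\<close>, whereas independence
  at \<open>b\<close> is obtained for smaller sets \<open>S\<close>. Since \<open>E\<close> spans as much as \<open>I\<close> for both families,
  passing from \<open>S\<close> to \<open>I \<union> S\<close> does not change the rank.
\<close>

lemma independent_family_pullback:
  assumes "finite S" "E \<subseteq> I" "E \<subseteq> S"
    and "a ` I \<subseteq> span (a ` E)" "b ` I \<subseteq> span (b ` E)"
    and "family_rank b (I \<union> S) = family_rank a (I \<union> S)"
    and "independent_family b S"
  shows "independent_family a S"
proof -
  have "E \<union> S = S" using assms(3) by blast
  then have "family_rank a S = family_rank b S"
    using family_rank_cong_span[OF assms(2,4), of S] family_rank_cong_span[OF assms(2,5), of S]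
      assms(6) by simp
  then show ?thesis using assms(1,7) by (simp add: independent_family_iff_full_rank)
qed

section \<open>Caratheodory's reduction\<close>

text \<open>
  The indices in \<open>E\<close>, whose coefficients are unrestricted in sign, are all kept. This is possible
  because \<open>E\<close> is independent: every linear dependency involves an index outside \<open>E\<close>, and
  subtracting a suitable multiple of it removes one of those.
\<close>

lemma conic_Caratheodory:
  fixes a :: "'i \<Rightarrow> 'h::real_vector"
  assumes "finite A" "E \<subseteq> A" "independent_family a E"
    and "v = (\<Sum>i\<in>A. u i *\<^sub>R a i)" "\<forall>i\<in>A - E. 0 \<le> u i"
  shows "\<exists>S u. E \<subseteq> S \<and> S \<subseteq> A \<and> independent_family a S
    \<and> v = (\<Sum>i\<in>S. u i *\<^sub>R a i) \<and> (\<forall>i\<in>S - E. 0 \<le> u i)"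
  using assms(1,2,4,5)
proof (induction A arbitrary: u rule: finite_psubset_induct)
  case (psubset A)
  show ?case
  proof (cases "independent_family a A")
    case True
    then show ?thesis using psubset.prems by blast
  next
    case False
    then obtain c where c: "(\<Sum>i\<in>A. c i *\<^sub>R a i) = 0" "\<exists>i\<in>A. c i \<noteq> 0"
      unfolding independent_family_def by blast
    have "\<exists>i\<in>A - E. c i \<noteq> 0"
    proof (rule ccontr)
      assume no: "\<not> ?thesis"
      then have "(\<Sum>i\<in>E. c i *\<^sub>R a i) = (\<Sum>i\<in>A. c i *\<^sub>R a i)"
        using psubset.hyps psubset.prems(1) by (intro sum.mono_neutral_left) auto
      then have "\<forall>i\<in>E. c i = 0" using c(1) assms(3) unfolding independent_family_def by simp
      then show False using no c(2) by blast
    qed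
    then obtain j where j: "j \<in> A - E" "c j \<noteq> 0" by blast
    \<comment> \<open>Flip the sign of the dependency, so that some coefficient outside \<open>E\<close> is positive.\<close>
    define b where "b i = sgn (c j) * c i" for i
    have b: "(\<Sum>i\<in>A. b i *\<^sub>R a i) = 0" "b j > 0"
    proof -
      have "(\<Sum>i\<in>A. b i *\<^sub>R a i) = sgn (c j) *\<^sub>R (\<Sum>i\<in>A. c i *\<^sub>R a i)"
        by (simp add: b_def scaleR_sum_right)
      then show "(\<Sum>i\<in>A. b i *\<^sub>R a i) = 0" using c(1) by simp
      show "b j > 0" using j(2) by (simp add: b_def sgn_if)
    qed
    define P where "P = {i \<in> A - E. b i > 0}"
    have "finite P" "P \<noteq> {}" using psubset.hyps j b(2) by (auto simp: P_def)
    then obtain k where k: "k \<in> P" "\<And>i. i \<in> P \<Longrightarrow> u k / b k \<le> u i / b i"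
      using arg_min_if_finite[of P "\<lambda>i. u i / b i"] by (metis not_le)
    \<comment> \<open>The largest multiple of \<open>b\<close> whose subtraction keeps the coefficients outside \<open>E\<close>
        nonnegative.\<close>
    define t where "t = u k / b k"
    define u' where "u' i = u i - t * b i" for i
    have t0: "t \<ge> 0" using k(1) psubset.prems(3) by (auto simp: t_def P_def)
    have "u' k = 0" using k(1) by (auto simp: u'_def t_def P_def)
    have pos: "u' i \<ge> 0" if "i \<in> A - E" for i
    proof (cases "b i > 0")
      case True
      then show ?thesis using k(2)[of i] that by (simp add: P_def u'_def t_def pos_le_divide_eq)
    next
      case False
      then have "t * b i \<le> 0" using t0 by (simp add: mult_nonneg_nonpos)
      then show ?thesis using psubset.prems(3) that unfolding u'_def by force
    qed
    have "(\<Sum>i\<in>A. u' i *\<^sub>R a i) = (\<Sum>i\<in>A. u i *\<^sub>R a i) - t *\<^sub>R (\<Sum>i\<in>A. b i *\<^sub>R a i)"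
      by (simp add: u'_def scaleR_diff_left sum_subtractf scaleR_sum_right)
    then have "v = (\<Sum>i\<in>A. u' i *\<^sub>R a i)" using b(1) psubset.prems(2) by simp
    also have "\<dots> = (\<Sum>i\<in>A - {k}. u' i *\<^sub>R a i)"
      using psubset.hyps \<open>u' k = 0\<close> by (intro sum.mono_neutral_right) auto
    finally have "v = (\<Sum>i\<in>A - {k}. u' i *\<^sub>R a i)" .
    moreover have "A - {k} \<subset> A" "E \<subseteq> A - {k}" using k(1) psubset.prems(1) by (auto simp: P_def)
    ultimately show ?thesis using psubset.IH[of "A - {k}" u'] pos by blast
  qed
qed

section \<open>Uniform bounds on coefficients\<close>

text \<open>
  Otherwise \<open>x \<bullet> a j = 0\<close> for all \<open>x\<close> orthogonal to the other vectors, and Farkas' lemma with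
  equations only represents \<open>a j\<close> by the others.
\<close>

lemma dual_vector_exists:
  fixes a :: "'i \<Rightarrow> 'h::real_inner"
  assumes "finite S" "independent_family a S" "j \<in> S"
  shows "\<exists>w. w \<bullet> a j = 1 \<and> (\<forall>i\<in>S - {j}. w \<bullet> a i = 0)"
proof (rule ccontr)
  assume no: "\<not> ?thesis"
  have "x \<bullet> a j \<le> 0" if x: "\<forall>i\<in>S - {j}. x \<bullet> a i = 0" for x
  proof (rule ccontr)
    assume "\<not> x \<bullet> a j \<le> 0"
    then show False using no x by (auto dest!: spec[of _ "(1 / (x \<bullet> a j)) *\<^sub>R x"])
  qed
  then obtain u where u: "a j = (\<Sum>i\<in>S - {j}. u i *\<^sub>R a i)"
    using mixed_Farkas[of "S - {j}" "S - {j}" a "a j"] assms(1) by auto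
  have "(\<Sum>i\<in>S. (u(j := -1)) i *\<^sub>R a i) = 0"
    using assms(1,3) u by (simp add: sum.remove[of S j])
  then have "(u(j := -1)) j = 0" using assms(2,3) unfolding independent_family_def by blast
  then show False by simp
qed

text \<open>
  Pairing \<open>\<Sum>i\<in>S. u i *\<^sub>R a i\<close> with a dual vector reads off a coefficient, which bounds the
  coefficients for the limit family \<open>a\<close>. For \<open>g i p\<close> close to \<open>a i\<close> the perturbation costs at most
  half of \<open>\<Sum>i\<in>S. \<bar>u i\<bar>\<close> and can be absorbed on the left-hand side.
\<close>

lemma uniform_coefficient_bound:
  fixes a :: "'i \<Rightarrow> 'h::real_inner" and g :: "'i \<Rightarrow> 'p \<Rightarrow> 'h"
  assumes "finite S" "independent_family a S" "\<And>i. i \<in> S \<Longrightarrow> (g i \<longlongrightarrow> a i) F"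
  shows "\<exists>c\<ge>0. \<forall>\<^sub>F p in F. \<forall>u. (\<Sum>i\<in>S. \<bar>u i\<bar>) \<le> c * norm (\<Sum>i\<in>S. u i *\<^sub>R g i p)"
proof -
  obtain w where w: "\<And>j. j \<in> S \<Longrightarrow> w j \<bullet> a j = 1"
      "\<And>i j. j \<in> S \<Longrightarrow> i \<in> S - {j} \<Longrightarrow> w j \<bullet> a i = 0"
    using dual_vector_exists[OF assms(1,2)] by metis
  define W where "W = (\<Sum>j\<in>S. norm (w j))"
  \<comment> \<open>\<open>W + 1\<close> rather than \<open>W\<close> covers the empty family, where \<open>W = 0\<close>.\<close>
  define e where "e = 1 / (2 * (W + 1))"
  have W0: "W \<ge> 0" by (simp add: W_def sum_nonneg)
  then have e0: "e > 0" "W * e \<le> 1 / 2" by (simp_all add: e_def field_simps)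
  have "\<forall>\<^sub>F p in F. \<forall>i\<in>S. dist (g i p) (a i) < e"
    using assms(1,3) e0(1) by (auto intro!: eventually_ball_finite tendstoD)
  then have "\<forall>\<^sub>F p in F. \<forall>u. (\<Sum>i\<in>S. \<bar>u i\<bar>) \<le> (2 * W) * norm (\<Sum>i\<in>S. u i *\<^sub>R g i p)"
  proof eventually_elim
    case (elim p)
    show ?case
    proof
      fix u :: "'i \<Rightarrow> real"
      define v where "v = (\<Sum>i\<in>S. u i *\<^sub>R g i p)"
      define U where "U = (\<Sum>i\<in>S. \<bar>u i\<bar>)"
      have "norm ((\<Sum>i\<in>S. u i *\<^sub>R a i) - v) \<le> (\<Sum>i\<in>S. \<bar>u i\<bar> * e)"
        unfolding v_def sum_subtractf[symmetric] scaleR_diff_right[symmetric]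
        using elim by (intro sum_norm_le)
          (auto simp: dist_norm norm_minus_commute intro!: mult_left_mono intro: less_imp_le)
      also have "\<dots> = U * e" by (simp add: U_def sum_distrib_right)
      finally have near: "norm (\<Sum>i\<in>S. u i *\<^sub>R a i) \<le> norm v + U * e"
        using norm_triangle_sub[of "\<Sum>i\<in>S. u i *\<^sub>R a i" v] by linarith
      have "\<bar>u j\<bar> \<le> norm (w j) * (norm v + U * e)" if "j \<in> S" for j
      proof -
        have "w j \<bullet> (\<Sum>i\<in>S. u i *\<^sub>R a i) = (\<Sum>i\<in>S. u i * (w j \<bullet> a i))"
          by (simp add: inner_sum_right)
        also have "\<dots> = u j"
          using assms(1) that w by (simp add: sum.remove[of S j])
        finally have "\<bar>u j\<bar> \<le> norm (w j) * norm (\<Sum>i\<in>S. u i *\<^sub>R a i)"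
          using Cauchy_Schwarz_ineq2[of "w j" "\<Sum>i\<in>S. u i *\<^sub>R a i"] by simp
        also have "\<dots> \<le> norm (w j) * (norm v + U * e)" using near by (intro mult_left_mono) auto
        finally show ?thesis .
      qed
      then have "U \<le> W * (norm v + U * e)"
        unfolding U_def W_def sum_distrib_right by (intro sum_mono) (simp add: U_def)
      moreover have "U * (W * e) \<le> U * (1 / 2)"
        using e0 by (intro mult_left_mono) (auto simp: U_def sum_nonneg)
      ultimately show "U \<le> (2 * W) * norm v" by (simp add: algebra_simps)
    qed
  qed
  then show ?thesis using W0 by (intro exI[of _ "2 * W"]) auto
qed

lemma uniform_coefficient_bound_families:
  fixes a :: "'i \<Rightarrow> 'h::real_inner" and g :: "'i \<Rightarrow> 'p \<Rightarrow> 'h"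
  assumes "finite \<S>" "\<And>S. S \<in> \<S> \<Longrightarrow> finite S" "\<And>S. S \<in> \<S> \<Longrightarrow> independent_family a S"
    and "\<And>S i. S \<in> \<S> \<Longrightarrow> i \<in> S \<Longrightarrow> (g i \<longlongrightarrow> a i) F"
  obtains c where "0 \<le> c"
    "\<forall>\<^sub>F p in F. \<forall>S\<in>\<S>. \<forall>u. (\<Sum>i\<in>S. \<bar>u i\<bar>) \<le> c * norm (\<Sum>i\<in>S. u i *\<^sub>R g i p)"
proof -
  define bounds where
    "bounds c S p \<longleftrightarrow> (\<forall>u. (\<Sum>i\<in>S. \<bar>u i\<bar>) \<le> c * norm (\<Sum>i\<in>S. u i *\<^sub>R g i p))" for c S p
  have "\<exists>c\<ge>0. \<forall>\<^sub>F p in F. bounds c S p" if "S \<in> \<S>" for S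
    unfolding bounds_def
    using that by (intro uniform_coefficient_bound[where a = a] assms(2,3) assms(4)[of S])
  then obtain c0 where c0: "\<And>S. S \<in> \<S> \<Longrightarrow> 0 \<le> c0 S"
      "\<And>S. S \<in> \<S> \<Longrightarrow> \<forall>\<^sub>F p in F. bounds (c0 S) S p"
    by metis
  define c where "c = (\<Sum>S\<in>\<S>. c0 S)"
  have mono: "bounds c S p" if "bounds (c0 S) S p" "S \<in> \<S>" for S p
    unfolding bounds_def
  proof
    fix u :: "'i \<Rightarrow> real"
    have "c0 S \<le> c" unfolding c_def using that(2) c0(1) assms(1) by (intro member_le_sum) auto
    then have "c0 S * norm (\<Sum>i\<in>S. u i *\<^sub>R g i p) \<le> c * norm (\<Sum>i\<in>S. u i *\<^sub>R g i p)"
      by (rule mult_right_mono) simp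
    then show "(\<Sum>i\<in>S. \<bar>u i\<bar>) \<le> c * norm (\<Sum>i\<in>S. u i *\<^sub>R g i p)"
      using that(1)[unfolded bounds_def, rule_format, of u] by linarith
  qed
  have "\<forall>\<^sub>F p in F. \<forall>S\<in>\<S>. bounds (c0 S) S p"
    using c0(2) assms(1) by (intro eventually_ball_finite ballI)
  then have "\<forall>\<^sub>F p in F. \<forall>S\<in>\<S>. bounds c S p"
    by eventually_elim (simp add: mono)
  moreover have "0 \<le> c" unfolding c_def using c0(1) by (rule sum_nonneg)
  ultimately show ?thesis using that unfolding bounds_def by blast
qed

section \<open>The residual of a point and its distance to a polyhedron\<close>

text \<open>
  If \<open>d\<close> is orthogonal to the equality gradients and makes a non-acute angle with the active
  inequality gradients, then \<open>z + t *\<^sub>R d\<close> is feasible for small \<open>t > 0\<close>, so that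
  \<open>d \<bullet> (x - z) \<le> 0\<close> by minimality of \<open>z\<close>. Farkas' lemma turns this into multipliers, of which
  Caratheodory's reduction leaves an independent set. As \<open>E\<close> spans the gradients of all
  equations, \<open>d\<close> only has to be tested against \<open>E\<close>, and no other equation receives a multiplier.
\<close>

lemma nearest_point_multipliers:
  fixes a :: "'i \<Rightarrow> 'h::real_inner"
  assumes fin: "finite I" "finite K"
    and E: "E \<subseteq> I" "independent_family a E" "a ` I \<subseteq> span (a ` E)"
    and z: "\<forall>i\<in>I. z \<bullet> a i = b i" "\<forall>i\<in>K. z \<bullet> a i \<le> b i"
    and nearest: "\<forall>y. (\<forall>i\<in>I. y \<bullet> a i = b i) \<and> (\<forall>i\<in>K. y \<bullet> a i \<le> b i)
      \<longrightarrow> norm (x - z) \<le> norm (x - y)"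
  shows "\<exists>S u. E \<subseteq> S \<and> S \<subseteq> E \<union> {i \<in> K. z \<bullet> a i = b i} \<and> independent_family a S
    \<and> x - z = (\<Sum>i\<in>S. u i *\<^sub>R a i) \<and> (\<forall>i\<in>S - E. 0 \<le> u i)"
proof -
  define A where "A = E \<union> {i \<in> K. z \<bullet> a i = b i}"
  have "finite A" using fin E(1) finite_subset by (auto simp: A_def)
  have "d \<bullet> (x - z) \<le> 0" if d: "\<forall>i\<in>A. if i \<in> E then d \<bullet> a i = 0 else d \<bullet> a i \<le> 0" for d
  proof -
    have "span (a ` E) \<subseteq> {v. d \<bullet> v = 0}"
      using d by (intro span_minimal subspace_hyperplane) (auto simp: A_def)
    then have dI: "d \<bullet> a i = 0" if "i \<in> I" for i using E(3) that by auto
    have dK: "d \<bullet> a i \<le> 0" if "i \<in> K" "z \<bullet> a i = b i" for i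
      using d that by (cases "i \<in> E") (auto simp: A_def)
    have "\<forall>\<^sub>F t in at_right 0. \<forall>i\<in>{i \<in> K. z \<bullet> a i < b i}. (z + t *\<^sub>R d) \<bullet> a i < b i"
    proof (intro eventually_ball_finite ballI)
      fix i assume "i \<in> {i \<in> K. z \<bullet> a i < b i}"
      moreover have "((\<lambda>t. (z + t *\<^sub>R d) \<bullet> a i) \<longlongrightarrow> (z + 0 *\<^sub>R d) \<bullet> a i) (at_right 0)"
        by (intro tendsto_intros)
      ultimately show "\<forall>\<^sub>F t in at_right 0. (z + t *\<^sub>R d) \<bullet> a i < b i"
        by (intro order_tendstoD(2)) auto
    qed (use fin in simp)
    moreover have "\<forall>\<^sub>F t in at_right (0::real). 0 < t" by (rule eventually_at_right_less)
    ultimately have "\<forall>\<^sub>F t in at_right 0. 2 * (d \<bullet> (x - z)) \<le> t * (d \<bullet> d)"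
    proof eventually_elim
      case (elim t)
      have "(z + t *\<^sub>R d) \<bullet> a i \<le> b i" if "i \<in> K" for i
      proof (cases "z \<bullet> a i = b i")
        case True
        then show ?thesis
          using dK[OF that] elim(2) by (simp add: inner_add_left mult_nonneg_nonpos)
      next
        case False
        then show ?thesis using elim(1) z(2) that by (simp add: less_le)
      qed
      moreover have "(z + t *\<^sub>R d) \<bullet> a i = b i" if "i \<in> I" for i
        using dI[OF that] z(1) that by (simp add: inner_add_left)
      ultimately have "norm (x - z) \<le> norm (x - (z + t *\<^sub>R d))" using nearest by blast
      then have "(norm (x - z))\<^sup>2 \<le> (norm (x - (z + t *\<^sub>R d)))\<^sup>2" by (intro power_mono) auto
      \<comment> \<open>Expanding the squares leaves this first-order condition with a quadratic error term.\<close>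
      then have "t * (2 * (d \<bullet> (x - z))) \<le> t * (t * (d \<bullet> d))"
        unfolding power2_norm_eq_inner by (simp add: inner_commute algebra_simps)
      then show ?case using elim(2) by simp
    qed
    moreover have "((\<lambda>t. t * (d \<bullet> d)) \<longlongrightarrow> 0 * (d \<bullet> d)) (at_right 0)"
      by (intro tendsto_intros)
    ultimately have "2 * (d \<bullet> (x - z)) \<le> 0 * (d \<bullet> d)"
      by (intro tendsto_lowerbound) auto
    then show ?thesis by simp
  qed
  from mixed_Farkas[OF \<open>finite A\<close> this] obtain u
    where "x - z = (\<Sum>i\<in>A. u i *\<^sub>R a i)" "\<forall>i\<in>A - E. 0 \<le> u i" by blast
  from conic_Caratheodory[OF \<open>finite A\<close> _ E(2) this] show ?thesis by (simp add: A_def)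
qed

text \<open>
  Complementary slackness: every multiplier sits on a constraint active at \<open>z\<close>, so that
  \<open>(norm (x - z))\<^sup>2\<close> is the sum of the multipliers times the residuals \<open>x \<bullet> a i - b i\<close>. For an
  inequality the multiplier is nonnegative, hence an upper bound on its residual suffices.
\<close>

lemma distance_le_residual:
  fixes a :: "'i \<Rightarrow> 'h::real_inner"
  assumes xz: "x - z = (\<Sum>i\<in>S. u i *\<^sub>R a i)" and active: "\<And>i. i \<in> S \<Longrightarrow> z \<bullet> a i = b i"
    and eq: "\<And>i. i \<in> S \<inter> E \<Longrightarrow> \<bar>x \<bullet> a i - b i\<bar> \<le> \<eta>"
    and le: "\<And>i. i \<in> S - E \<Longrightarrow> 0 \<le> u i \<and> x \<bullet> a i - b i \<le> \<eta>"
    and bound: "(\<Sum>i\<in>S. \<bar>u i\<bar>) \<le> c * norm (x - z)" and "0 \<le> c" "0 \<le> \<eta>"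
  shows "norm (x - z) \<le> c * \<eta>"
proof (cases "x = z")
  case False
  have "(norm (x - z))\<^sup>2 = (x - z) \<bullet> (\<Sum>i\<in>S. u i *\<^sub>R a i)"
    using xz by (simp add: power2_norm_eq_inner)
  also have "\<dots> = (\<Sum>i\<in>S. u i * (x \<bullet> a i - b i))"
    using active by (simp add: inner_sum_right inner_diff_left)
  also have "\<dots> \<le> (\<Sum>i\<in>S. \<bar>u i\<bar> * \<eta>)"
  proof (rule sum_mono)
    fix i assume i: "i \<in> S"
    show "u i * (x \<bullet> a i - b i) \<le> \<bar>u i\<bar> * \<eta>"
    proof (cases "i \<in> E")
      case True
      have "u i * (x \<bullet> a i - b i) \<le> \<bar>u i\<bar> * \<bar>x \<bullet> a i - b i\<bar>" by (simp flip: abs_mult)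
      also have "\<dots> \<le> \<bar>u i\<bar> * \<eta>" using eq i True by (intro mult_left_mono) auto
      finally show ?thesis .
    next
      case False
      then show ?thesis using le[of i] i by (simp add: mult_left_mono)
    qed
  qed
  also have "\<dots> \<le> c * norm (x - z) * \<eta>"
    using bound \<open>0 \<le> \<eta>\<close> by (simp add: mult_right_mono flip: sum_distrib_right)
  finally have "norm (x - z) * norm (x - z) \<le> norm (x - z) * (c * \<eta>)"
    by (simp add: power2_eq_square mult_ac)
  then show ?thesis using False by simp
qed (use assms in simp)

section \<open>Dependence of the constraints on the parameter\<close>

lemma feasible_set_closed_convex: "closed (feasible_set m n f g p)" "convex (feasible_set m n f g p)"
proof -
  have *: "feasible_set m n f g p = (\<Inter>i\<in>{1..m}. {x. g i p \<bullet> x = f i p})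
      \<inter> (\<Inter>i\<in>{m+1..n}. {x. g i p \<bullet> x \<le> f i p})"
    by (auto simp: feasible_set_def inner_commute)
  show "closed (feasible_set m n f g p)" unfolding *
    by (intro closed_Int closed_INT ballI closed_hyperplane closed_halfspace_le)
  show "convex (feasible_set m n f g p)" unfolding *
    by (intro convex_Int convex_INT convex_hyperplane convex_halfspace_le)
qed

text \<open>
  The filter \<open>inf (nhds x) (principal D)\<close> describes relative neighbourhoods of \<open>x\<close> in \<open>D\<close>. Unlike
  \<open>at x within D\<close> it includes the point \<open>x\<close> itself, at which the estimates are needed as well.
\<close>

lemma eventually_openin:
  assumes "openin (top_of_set D) U" "x \<in> U"
  shows "\<forall>\<^sub>F p in inf (nhds x) (principal D). p \<in> U"
proof -
  obtain T where "open T" "U = D \<inter> T" using assms(1) unfolding openin_open by blast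
  then show ?thesis
    using assms(2) unfolding eventually_inf_principal eventually_nhds by (intro exI[of _ T]) simp
qed

lemma lipschitz_on_tendsto:
  assumes "L-lipschitz_on D h" "x \<in> D"
  shows "(h \<longlongrightarrow> h x) (inf (nhds x) (principal D))"
proof (rule topological_tendstoI)
  fix B assume "open B" "h x \<in> B"
  then show "\<forall>\<^sub>F p in inf (nhds x) (principal D). h p \<in> B"
    using lipschitz_on_continuous_on[OF assms(1)] assms(2)
    unfolding continuous_on_topological eventually_inf_principal eventually_nhds by metis
qed

text \<open>
  Here \<open>d\<close> stands for the distance of two parameters: moving the parameter changes the residual of
  a fixed point \<open>x\<close> by at most a multiple of \<open>d\<close>, locally uniformly in \<open>x\<close>.
\<close>

lemma residual_le:
  fixes g1 g2 x :: "'h::real_inner"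
  assumes "norm (g1 - g2) \<le> L * d" "\<bar>f1 - f2\<bar> \<le> L * d"
  shows "\<bar>(x \<bullet> g2 - f2) - (x \<bullet> g1 - f1)\<bar> \<le> (norm x + 1) * L * d"
proof -
  have "\<bar>x \<bullet> (g2 - g1)\<bar> \<le> norm x * norm (g1 - g2)"
    using Cauchy_Schwarz_ineq2[of x "g2 - g1"] by (simp add: norm_minus_commute)
  also have "\<dots> \<le> norm x * (L * d)" using assms(1) by (intro mult_left_mono) auto
  finally show ?thesis using assms(2) by (simp add: inner_diff_right algebra_simps)
qed

section \<open>The Lipschitz-like property\<close>

theorem theorem1:
  fixes D :: "'g::{real_inner, complete_space} set"
    and m n :: nat
    and f :: "nat \<Rightarrow> 'g \<Rightarrow> real"
    and g :: "nat \<Rightarrow> 'g \<Rightarrow> 'h::{real_inner, complete_space}"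
    and pbar :: 'g and xbar :: 'h
  assumes "D \<noteq> {}"
    and "m \<le> n"
    and "\<And>i. i \<in> {1..m} \<union> {m+1..n} \<Longrightarrow> \<exists>L. L-lipschitz_on D (f i)"
    and "\<And>i. i \<in> {1..m} \<union> {m+1..n} \<Longrightarrow> \<exists>L. L-lipschitz_on D (g i)"
    and "pbar \<in> D"
    and "xbar \<in> feasible_set m n f g pbar"
    and "RCRCQ m n D f g pbar xbar"
    and "xbar \<in> lower_limit D (feasible_set m n f g) pbar"
  shows "lipschitz_like D (feasible_set m n f g) pbar xbar"
proof -
  define I where "I = {1..m}"
  define K where "K = {m+1..n}"
  define F where "F = inf (nhds pbar) (principal D)"
  define a where "a = (\<lambda>i. g i pbar)"
  define A where "A = active_indices m n f g pbar xbar"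
  let ?C = "feasible_set m n f g"
  have fin: "finite I" "finite K" "finite A"
    by (auto simp: I_def K_def A_def active_indices_def)
  have feas: "x \<in> ?C p \<longleftrightarrow> (\<forall>i\<in>I. x \<bullet> g i p = f i p) \<and> (\<forall>i\<in>K. x \<bullet> g i p \<le> f i p)" for x p
    by (simp add: feasible_set_def I_def K_def)
  have A: "A = {i \<in> I \<union> K. xbar \<bullet> g i pbar = f i pbar}"
    by (simp add: A_def active_indices_def I_def K_def)
  have "I \<subseteq> A" using assms(6) by (auto simp: feas A)
  obtain Lf Lg where LfLg: "\<And>i. i \<in> I \<union> K \<Longrightarrow> (Lf i)-lipschitz_on D (f i)"
      "\<And>i. i \<in> I \<union> K \<Longrightarrow> (Lg i)-lipschitz_on D (g i)"
    using assms(3,4) unfolding I_def K_def by metis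
  define L where "L = (\<Sum>i\<in>I \<union> K. Lf i + Lg i)"
  have nn: "0 \<le> Lf j" "0 \<le> Lg j" if "j \<in> I \<union> K" for j
    using LfLg[OF that, THEN lipschitz_on_nonneg] .
  have L: "Lf i \<le> L \<and> Lg i \<le> L" if i: "i \<in> I \<union> K" for i
  proof -
    have "Lf i + Lg i \<le> L"
      unfolding L_def using fin nn i by (intro member_le_sum) auto
    then show ?thesis using nn[OF i] by linarith
  qed
  have "0 \<le> L" unfolding L_def by (intro sum_nonneg add_nonneg_nonneg nn)
  have lip: "norm (g i p - g i q) \<le> L * norm (p - q)" "\<bar>f i p - f i q\<bar> \<le> L * norm (p - q)"
    if "i \<in> I \<union> K" "p \<in> D" "q \<in> D" for i p q
    using lipschitz_on_normD[OF lipschitz_on_mono[OF LfLg(2)[OF that(1)] order_refl] that(2,3), of L]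
      lipschitz_on_normD[OF lipschitz_on_mono[OF LfLg(1)[OF that(1)] order_refl] that(2,3), of L]
      L[OF that(1)] by auto
  have tendsto: "(g i \<longlongrightarrow> a i) F" "(f i \<longlongrightarrow> f i pbar) F" if "i \<in> I \<union> K" for i
    unfolding F_def a_def
    using lipschitz_on_tendsto[OF LfLg(2)[OF that] assms(5)]
      lipschitz_on_tendsto[OF LfLg(1)[OF that] assms(5)] .
  obtain E where E: "E \<subseteq> I" "independent_family a E" "a ` I \<subseteq> span (a ` E)"
    using spanning_subfamily_exists[OF fin(1)] by blast
  have "finite E" using E(1) fin(1) finite_subset by blast
  have rank_E: "family_rank a I = card E"
    using family_rank_cong_span[OF E(1,3), of "{}"] E(2) \<open>finite E\<close>
    by (simp add: independent_family_iff_full_rank)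

  obtain U0 where U0: "openin (top_of_set D) U0" "pbar \<in> U0"
    and U0_rank: "\<forall>J. {1..m} \<subseteq> J \<and> J \<subseteq> active_indices m n f g pbar xbar \<longrightarrow>
      (\<forall>p\<in>U0. family_rank (\<lambda>i. g i p) J = family_rank (\<lambda>i. g i pbar) J)"
    using assms(7) unfolding RCRCQ_def by (elim exE conjE) (rule that)
  have rank: "family_rank (\<lambda>i. g i p) J = family_rank a J" if "I \<subseteq> J" "J \<subseteq> A" "p \<in> U0" for J p
    using U0_rank that unfolding I_def A_def a_def by simp
  have ev_rank: "\<forall>\<^sub>F p in F. p \<in> U0" unfolding F_def by (rule eventually_openin[OF U0])

  \<comment> \<open>The finitely many index sets that can carry multipliers, with one constant for all of them.\<close>
  define \<S> where "\<S> = {S. S \<subseteq> A \<and> independent_family a S}"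
  have "finite \<S>" using fin(3) by (simp add: \<S>_def)
  obtain c where "0 \<le> c" and ev_coeff:
    "\<forall>\<^sub>F p in F. \<forall>S\<in>\<S>. \<forall>u. (\<Sum>i\<in>S. \<bar>u i\<bar>) \<le> c * norm (\<Sum>i\<in>S. u i *\<^sub>R g i p)"
  proof (rule uniform_coefficient_bound_families)
    show "finite S" "independent_family a S" if "S \<in> \<S>" for S
      using that finite_subset[OF _ fin(3)] by (simp_all add: \<S>_def)
    show "(g i \<longlongrightarrow> a i) F" if "S \<in> \<S>" "i \<in> S" for S i
      using that by (intro tendsto(1)) (auto simp: \<S>_def A)
  qed (rule \<open>finite \<S>\<close>)

  \<comment> \<open>Constraints inactive at \<open>(pbar, xbar)\<close> stay inactive near it, jointly in point and parameter.\<close>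
  have "\<forall>\<^sub>F (x, p) in nhds xbar \<times>\<^sub>F F. \<forall>i\<in>K - A. x \<bullet> g i p < f i p"
    unfolding case_prod_unfold
  proof (intro eventually_ball_finite ballI)
    fix i assume i: "i \<in> K - A"
    have "((\<lambda>q. g i (snd q)) \<longlongrightarrow> a i) (nhds xbar \<times>\<^sub>F F)"
        "((\<lambda>q. f i (snd q)) \<longlongrightarrow> f i pbar) (nhds xbar \<times>\<^sub>F F)"
      using i tendsto[of i] by (auto intro: filterlim_compose[OF _ filterlim_snd])
    then have "((\<lambda>q. fst q \<bullet> g i (snd q) - f i (snd q)) \<longlongrightarrow> xbar \<bullet> a i - f i pbar) (nhds xbar \<times>\<^sub>F F)"
      by (intro tendsto_intros filterlim_fst)
    moreover have "xbar \<bullet> a i - f i pbar < 0"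
      using i assms(6) by (auto simp: A feas a_def less_le)
    ultimately have "\<forall>\<^sub>F q in nhds xbar \<times>\<^sub>F F. fst q \<bullet> g i (snd q) - f i (snd q) < 0"
      by (rule order_tendstoD(2))
    then show "\<forall>\<^sub>F q in nhds xbar \<times>\<^sub>F F. fst q \<bullet> g i (snd q) < f i (snd q)" by simp
  qed (use fin in simp)
  then obtain P Q where P: "\<forall>\<^sub>F x in nhds xbar. P x" and ev_slack: "\<forall>\<^sub>F p in F. Q p"
    and PQ: "\<forall>x p. P x \<longrightarrow> Q p \<longrightarrow> (\<forall>i\<in>K - A. x \<bullet> g i p < f i p)"
    unfolding eventually_prod_filter prod.case by (elim exE conjE) (rule that)
  from P obtain r where r: "0 < r" "\<forall>x. dist x xbar < r \<longrightarrow> P x"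
    unfolding eventually_nhds_metric by (elim exE conjE) (rule that)
  \<comment> \<open>A point within \<open>\<rho>\<close> of \<open>xbar\<close> has its nearest point in \<open>C(q)\<close> within \<open>3 * \<rho> \<le> r\<close> of \<open>xbar\<close>;
      \<open>\<rho> \<le> 1\<close> bounds its norm by \<open>norm xbar + 1\<close>.\<close>
  define \<rho> where "\<rho> = min 1 (r / 3)"
  have \<rho>: "0 < \<rho>" "\<rho> \<le> 1" "3 * \<rho> \<le> r" using r(1) by (auto simp: \<rho>_def)
  obtain U1 where U1: "openin (top_of_set D) U1" "pbar \<in> U1"
      "\<And>p. p \<in> U1 \<Longrightarrow> ?C p \<inter> ball xbar \<rho> \<noteq> {}"
    using assms(8) \<rho>(1) unfolding mem_lower_limit_iff[OF assms(5)]
    by (meson centre_in_ball open_ball)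
  have ev_nonempty: "\<forall>\<^sub>F p in F. p \<in> U1" unfolding F_def by (rule eventually_openin[OF U1(1,2)])

  from eventually_conj[OF ev_rank eventually_conj[OF ev_coeff eventually_conj[OF ev_slack ev_nonempty]]]
  obtain T where T: "open T" "pbar \<in> T" and T_good: "\<forall>p\<in>T. p \<in> D \<longrightarrow>
      p \<in> U0 \<and> (\<forall>S\<in>\<S>. \<forall>u. (\<Sum>i\<in>S. \<bar>u i\<bar>) \<le> c * norm (\<Sum>i\<in>S. u i *\<^sub>R g i p)) \<and> Q p \<and> p \<in> U1"
    unfolding F_def eventually_inf_principal eventually_nhds by (elim exE conjE) (rule that)
  have good: "p \<in> U0" "Q p" "p \<in> U1"
      "\<forall>S\<in>\<S>. \<forall>u. (\<Sum>i\<in>S. \<bar>u i\<bar>) \<le> c * norm (\<Sum>i\<in>S. u i *\<^sub>R g i p)" if "p \<in> D \<inter> T" for p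
    using T_good that by simp_all

  define M where "M = (norm xbar + 2) * L"
  have "0 \<le> M" using \<open>0 \<le> L\<close> by (simp add: M_def)
  have key: "\<exists>z\<in>?C q. norm (x - z) \<le> c * (M * norm (p - q))"
    if p: "p \<in> D \<inter> T" and q: "q \<in> D \<inter> T" and x: "x \<in> ?C p" "x \<in> ball xbar \<rho>" for p q x
  proof -
    obtain y where y: "y \<in> ?C q" "y \<in> ball xbar \<rho>" using U1(3) good[OF q] by blast
    obtain z where z: "z \<in> ?C q" "\<And>w. w \<in> ?C q \<Longrightarrow> norm (x - z) \<le> norm (x - w)"
      using nearest_point_exists[OF feasible_set_closed_convex, of m n f g q x] y(1)
      by (auto simp: dist_norm)
    have "dist z xbar < r"
    proof -
      have "dist x z \<le> dist x y" using z(2)[OF y(1)] by (simp add: dist_norm)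
      moreover have "dist x y < 2 * \<rho>"
        using x(2) y(2) dist_triangle[of x y xbar] by (simp add: dist_commute)
      moreover have "dist z xbar \<le> dist x z + dist x xbar"
        using dist_triangle[of z xbar x] by (simp add: dist_commute)
      ultimately show ?thesis using x(2) \<rho>(3) by (simp add: dist_commute)
    qed
    then have active: "i \<in> A" if "i \<in> K" "z \<bullet> g i q = f i q" for i
      using PQ r(2) good[OF q] that by (metis DiffI less_irrefl)
    define b where "b = (\<lambda>i. g i q)"
    have coeff: "(\<Sum>i\<in>S. \<bar>u i\<bar>) \<le> c * norm (\<Sum>i\<in>S. u i *\<^sub>R b i)" if "S \<in> \<S>" for S u
      using good[OF q] that by (auto simp: b_def)
    have rank_b: "family_rank b J = family_rank a J" if "I \<subseteq> J" "J \<subseteq> A" for J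
      using rank[OF that] good[OF q] by (simp add: b_def)
    \<comment> \<open>The coefficient bound for \<open>E\<close> carries independence from \<open>pbar\<close> to \<open>q\<close>, and constant rank
        of the equality gradients then makes \<open>E\<close> span them at \<open>q\<close> too.\<close>
    have "independent_family b E"
      unfolding independent_family_def
    proof (intro allI impI ballI)
      fix u i assume u: "(\<Sum>i\<in>E. u i *\<^sub>R b i) = 0" "i \<in> E"
      have "E \<in> \<S>" using E(1,2) \<open>I \<subseteq> A\<close> by (auto simp: \<S>_def)
      from coeff[OF this, of u] have "(\<Sum>i\<in>E. \<bar>u i\<bar>) \<le> 0" using u(1) by simp
      moreover have "\<bar>u i\<bar> \<le> (\<Sum>i\<in>E. \<bar>u i\<bar>)"
        using u(2) \<open>finite E\<close> by (intro member_le_sum) auto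
      ultimately show "u i = 0" by linarith
    qed
    then have span_b: "b ` I \<subseteq> span (b ` E)"
      using rank_b[OF order_refl \<open>I \<subseteq> A\<close>] rank_E fin(1) E(1)
      by (intro full_rank_subfamily_spans) auto
    have z_feasible: "\<forall>i\<in>I. z \<bullet> b i = f i q" "\<forall>i\<in>K. z \<bullet> b i \<le> f i q"
      using z(1) by (simp_all add: feas b_def)
    have "\<forall>w. (\<forall>i\<in>I. w \<bullet> b i = f i q) \<and> (\<forall>i\<in>K. w \<bullet> b i \<le> f i q)
        \<longrightarrow> norm (x - z) \<le> norm (x - w)"
      using z(2) by (simp add: feas b_def)
    from nearest_point_multipliers[OF fin(1,2) E(1) \<open>independent_family b E\<close> span_b z_feasible this]
    obtain S u where S: "E \<subseteq> S" "S \<subseteq> E \<union> {i \<in> K. z \<bullet> b i = f i q}" "independent_family b S"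
      and u: "x - z = (\<Sum>i\<in>S. u i *\<^sub>R b i)" "\<forall>i\<in>S - E. 0 \<le> u i"
      by (elim exE conjE) (rule that)
    have "S \<subseteq> A" using S(2) E(1) \<open>I \<subseteq> A\<close> active by (auto simp: b_def)
    have "independent_family a S"
    proof (rule independent_family_pullback[OF _ E(1) S(1) E(3) span_b _ S(3)])
      show "finite S" using \<open>S \<subseteq> A\<close> fin(3) finite_subset by blast
      show "family_rank b (I \<union> S) = family_rank a (I \<union> S)"
        using \<open>S \<subseteq> A\<close> \<open>I \<subseteq> A\<close> by (intro rank_b) auto
    qed
    then have "S \<in> \<S>" using \<open>S \<subseteq> A\<close> by (simp add: \<S>_def)
    have "norm x \<le> norm xbar + 1"
      using x(2) \<rho>(2) norm_triangle_sub[of x xbar] by (simp add: dist_norm norm_minus_commute)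
    then have "(norm x + 1) * L * norm (p - q) \<le> M * norm (p - q)"
      unfolding M_def using \<open>0 \<le> L\<close> by (intro mult_right_mono) auto
    then have res: "\<bar>(x \<bullet> b i - f i q) - (x \<bullet> g i p - f i p)\<bar> \<le> M * norm (p - q)"
      if "i \<in> I \<union> K" for i
      using residual_le[OF lip[OF that, of p q], of x] p q by (simp add: b_def)
    have "norm (x - z) \<le> c * (M * norm (p - q))"
    proof (rule distance_le_residual[OF u(1), where b = "\<lambda>i. f i q" and E = E])
      fix i
      show "z \<bullet> b i = f i q" if "i \<in> S"
        using that S(2) E(1) z(1) by (auto simp: feas b_def)
      show "\<bar>x \<bullet> b i - f i q\<bar> \<le> M * norm (p - q)" if "i \<in> S \<inter> E"
        using that res[of i] E(1) x(1) by (auto simp: feas)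
      show "0 \<le> u i \<and> x \<bullet> b i - f i q \<le> M * norm (p - q)" if "i \<in> S - E"
      proof -
        have "i \<in> K" using that S(2) by auto
        then have "x \<bullet> g i p \<le> f i p" using x(1) by (simp add: feas)
        then show ?thesis using res[of i] u(2) that \<open>i \<in> K\<close> by (auto simp: abs_le_iff)
      qed
      show "(\<Sum>i\<in>S. \<bar>u i\<bar>) \<le> c * norm (x - z)" using coeff[OF \<open>S \<in> \<S>\<close>] u(1) by simp
    qed (use \<open>0 \<le> c\<close> \<open>0 \<le> M\<close> in auto)
    then show ?thesis using z(1) by blast
  qed

  \<comment> \<open>Adding 1 makes the estimate strict for \<open>p \<noteq> q\<close>, as the open unit ball requires.\<close>
  define l where "l = c * M + 1"
  have "0 < l" using \<open>0 \<le> c\<close> \<open>0 \<le> M\<close> by (simp add: l_def add_nonneg_pos)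
  have "\<exists>y b. x = y + (l * norm (p - q)) *\<^sub>R b \<and> y \<in> ?C q \<and> b \<in> ball 0 1"
    if pq: "p \<in> D \<inter> T" "q \<in> D \<inter> T" and x: "x \<in> ?C p" "x \<in> ball xbar \<rho>" for p q x
  proof -
    obtain z where z: "z \<in> ?C q" "norm (x - z) \<le> c * (M * norm (p - q))"
      using key[OF pq x] by blast
    show ?thesis
    proof (cases "p = q")
      case True
      then show ?thesis using x(1) by (intro exI[of _ x] exI[of _ 0]) simp
    next
      case False
      define s where "s = l * norm (p - q)"
      have "0 < s" using False \<open>0 < l\<close> by (simp add: s_def)
      moreover have "norm (x - z) < s"
      proof -
        have "s = c * (M * norm (p - q)) + norm (p - q)"
          by (simp add: s_def l_def algebra_simps)
        moreover have "0 < norm (p - q)" using False by simp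
        ultimately show ?thesis using z(2) by linarith
      qed
      ultimately have "(1 / s) *\<^sub>R (x - z) \<in> ball 0 1" by simp
      moreover have "x = z + s *\<^sub>R ((1 / s) *\<^sub>R (x - z))" using \<open>0 < s\<close> by simp
      ultimately show ?thesis
        using z(1) unfolding s_def[symmetric]
        by (intro exI[of _ z] exI[of _ "(1 / s) *\<^sub>R (x - z)"]) simp
    qed
  qed
  then have incl: "?C p \<inter> ball xbar \<rho>
      \<subseteq> {y + (l * norm (p - q)) *\<^sub>R b | y b. y \<in> ?C q \<and> b \<in> ball 0 1}"
    if "p \<in> D \<inter> T" "q \<in> D \<inter> T" for p q
    using that by (intro subsetI) (simp only: mem_Collect_eq Int_iff)
  have "openin (top_of_set D) (D \<inter> T)" using T(1) by (rule openin_open_Int)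
  moreover have "pbar \<in> D \<inter> T" "xbar \<in> ball xbar \<rho>" using T(2) assms(5) \<rho>(1) by simp_all
  ultimately show ?thesis
    unfolding lipschitz_like_def using \<open>0 < l\<close> incl open_ball by meson
qed

end
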